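(* Let $n$ be a positive integer. For $k=2,3,4$, the list $\mathcal{F}_k$ of $k$-sparse split sets in $\mathbb{R}^n$ with coefficients in $\{-1,0,1\}$ satisfies $C(\mathcal{F}_k)\le k-1$.
   Context: For $\pi\in\mathbb{Z}^n$ and $\eta\in\mathbb{Z}$, the split set is the open set $S(\pi,\eta):=\{x\in\mathbb{R}^n \mid \eta<\pi^{\top}x<\eta+1\}$. Let $\|\pi\|_0$ denote the number of non-zero entries of $\pi$; the split set $S(\pi,\eta)$ is called $k$-sparse if $\|\pi\|_0\le k$. $\mathcal{F}_k$ denotes the finite list of all $k$-sparse split sets $S(\pi,\eta)\subseteq\mathbb{R}^n$ with $\pi\in\{-1,0,1\}^n$, $\|\pi\|_0\le k$, and $\eta\in\{-k,\dots,-1,0,1,\dots,k\}$. A collection of split sets $\{S(\pi^i,\eta^i)\}_{i=1}^p$ in $\mathbb{R}^n$ dominates a split set $S(\pi^0,\eta^0)\subseteq\mathbb{R}^n$ if $$\Big(\bigcup_{i=1}^p S(\pi^i,\eta^i)\Big)\cap[0,1]^n\supseteq S(\pi^0,\eta^0)\cap[0,1]^n.$$ Covering number: let $\mathcal{F}$ be a finite list of $k$-sparse split sets in $\mathbb{R}^n$. For a $k$-sparse split set $S$ in $\mathbb{R}^n$, let $\mathcal{F}(S)$ be the smallest number of split sets from $\mathcal{F}$ that (together) dominate $S$, with $\mathcal{F}(S)=+\infty$ if no collection of split sets from $\mathcal{F}$ dominates $S$. The covering number of $\mathcal{F}$ is $$C(\mathcal{F}):=\max\{\mathcal{F}(S)\mid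 S\text{ is a }k\text{-sparse split set in }\mathbb{R}^n\}.$$ *)

theory Defs
  imports "HOL-Analysis.Analysis" "HOL-Library.Extended_Nat"
begin

definition split_set :: "int ^ 'n \<Rightarrow> int \<Rightarrow> (real ^ 'n) set" where
  "split_set \<pi> \<eta> =
     {x. of_int \<eta> < (\<chi> i. of_int (\<pi> $ i)) \<bullet> x \<and> (\<chi> i. of_int (\<pi> $ i)) \<bullet> x < of_int \<eta> + 1}"

definition nnz :: "int ^ 'n \<Rightarrow> nat" where
  "nnz \<pi> = card {i. \<pi> $ i \<noteq> 0}"

(* A split set has several descriptions, since S(\<pi>, \<eta>) = S(-\<pi>, -\<eta> - 1) and S(0, \<eta>) is empty.
   As a set it is k-sparse if one of its descriptions is. *)
definition sparse_split_set :: "nat \<Rightarrow> (real ^ 'n) set \<Rightarrow> bool" where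
  "sparse_split_set k S \<longleftrightarrow> (\<exists>\<pi> \<eta>. S = split_set \<pi> \<eta> \<and> nnz \<pi> \<le> k)"

definition unit_split_sets :: "nat \<Rightarrow> (real ^ 'n) set set" where
  "unit_split_sets k =
     {split_set \<pi> \<eta> | \<pi> \<eta>. (\<forall>i. \<pi> $ i \<in> {-1, 0, 1}) \<and> nnz \<pi> \<le> k \<and> \<eta> \<in> {- int k..int k}}"

(* In real ^ 'n the constant 1 is the all-ones vector, so cbox 0 1 is the cube [0,1]^n. *)
definition dominates :: "(real ^ 'n) set set \<Rightarrow> (real ^ 'n) set \<Rightarrow> bool" where
  "dominates \<G> S \<longleftrightarrow> S \<inter> cbox 0 1 \<subseteq> \<Union>\<G> \<inter> cbox 0 1"

(* The infimum of the empty set of extended naturals is \<infinity>, which covers the case that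
   no collection of members of \<F> dominates S. *)
definition domination_number :: "(real ^ 'n) set set \<Rightarrow> (real ^ 'n) set \<Rightarrow> enat" where
  "domination_number \<F> S = (INF \<G> \<in> {\<G>. \<G> \<subseteq> \<F> \<and> finite \<G> \<and> dominates \<G> S}. enat (card \<G>))"

(* For finite \<F> this supremum is a maximum, see covering_number_eq_Max. *)
definition covering_number :: "nat \<Rightarrow> (real ^ 'n) set set \<Rightarrow> enat" where
  "covering_number k \<F> = (SUP S \<in> {S. sparse_split_set k S}. domination_number \<F> S)"

lemma finite_unit_split_sets: "finite (unit_split_sets k :: (real ^ 'n) set set)"
proof -
  let ?P = "{\<pi> :: int ^ 'n. \<forall>i. \<pi> $ i \<in> {-1, 0, 1}}"
  have "vec_lambda ` (PiE UNIV (\<lambda>_. {-1, 0, 1})) = ?P"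
  proof (intro equalityI subsetI)
    fix \<pi> :: "int ^ 'n"
    assume "\<pi> \<in> ?P"
    then have "vec_nth \<pi> \<in> PiE UNIV (\<lambda>_. {-1, 0, 1})"
      by (auto simp: PiE_UNIV_domain)
    then show "\<pi> \<in> vec_lambda ` (PiE UNIV (\<lambda>_. {-1, 0, 1}))"
      by (metis image_eqI vec_nth_inverse)
  qed auto
  moreover have "finite (PiE (UNIV :: 'n set) (\<lambda>_. {-1, 0, 1 :: int}))"
    by (intro finite_PiE) auto
  ultimately have "finite ?P"
    by (metis finite_imageI)
  then have "finite ((\<lambda>(\<pi>, \<eta>). split_set \<pi> \<eta>) ` (?P \<times> {- int k..int k}))"
    by blast
  then show ?thesis
    by (rule rev_finite_subset) (auto simp: unit_split_sets_def)
qed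

lemma sparse_unit_split_sets: "S \<in> unit_split_sets k \<Longrightarrow> sparse_split_set k S"
  by (auto simp: unit_split_sets_def sparse_split_set_def)

lemma covering_number_eq_Max:
  fixes \<F> :: "(real ^ 'n) set set"
  assumes "finite \<F>"
  shows "covering_number k \<F> = Max {domination_number \<F> S | S. sparse_split_set k S}"
proof -
  let ?D = "{domination_number \<F> S | S. sparse_split_set k S}"
  have "domination_number \<F> S \<in> insert \<infinity> (enat ` card ` Pow \<F>)" for S
  proof (cases "{\<G>. \<G> \<subseteq> \<F> \<and> finite \<G> \<and> dominates \<G> S} = {}")
    case True
    then show ?thesis
      by (simp only: domination_number_def) (simp add: top_enat_def)
  next
    case False
    then obtain \<G> where "\<G> \<in> {\<G>. \<G> \<subseteq> \<F> \<and> finite \<G> \<and> dominates \<G> S}"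
      by blast
    then have "domination_number \<F> S \<in>
        (\<lambda>\<G>. enat (card \<G>)) ` {\<G>. \<G> \<subseteq> \<F> \<and> finite \<G> \<and> dominates \<G> S}"
      unfolding domination_number_def by (rule wellorder_InfI[OF imageI])
    then show ?thesis
      by auto
  qed
  then have "?D \<subseteq> insert \<infinity> (enat ` card ` Pow \<F>)"
    by auto
  then have fin: "finite ?D"
    by (rule finite_subset) (use assms in auto)
  have "sparse_split_set k (split_set (0 :: int ^ 'n) 0)"
    unfolding sparse_split_set_def by (intro exI[of _ 0]) (simp add: nnz_def)
  then have "?D \<noteq> {}"
    by blast
  have "covering_number k \<F> = Sup ?D"
    unfolding covering_number_def by (rule arg_cong[of _ _ Sup]) auto
  also have "\<dots> = Max ?D"
    by (rule Max_Sup[OF fin \<open>?D \<noteq> {}\<close>, symmetric])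
  finally show ?thesis .
qed

end

theory Submission
  imports Defs
begin

text \<open>
  The cube is invariant under the flips \<open>x\<^sub>i \<mapsto> 1 - x\<^sub>i\<close>, and a flip turns a split set with
  coefficients in \<open>{-1, 0, 1}\<close> into another one with the same support. Flipping the coordinates
  with negative coefficient, one may therefore assume that the slab is
  \<open>\<eta> < a x\<^sub>1 + b x\<^sub>2 + c x\<^sub>3 + d x\<^sub>4 < \<eta> + 1\<close> with \<open>a \<ge> b \<ge> c \<ge> d > 0\<close> (or has fewer terms).
  Flipping all coordinates replaces \<open>\<eta>\<close> by \<open>T - 1 - \<eta>\<close>, where \<open>T\<close> is the sum of the
  coefficients (\<open>unit_covers_reflect\<close>).

  If \<open>\<eta> < a\<close>, then \<open>x\<^sub>1 < 1\<close> on the slab, because \<open>a\<close> is an integer and so \<open>a \<ge> \<eta> + 1\<close>. Hence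
  the split \<open>0 < x\<^sub>1 < 1\<close> covers everything except the face \<open>x\<^sub>1 = 0\<close>, where one coefficient
  fewer is left (\<open>unit_covers_drop_coordinate\<close>). This and its reflection, \<open>\<eta> \<ge> T - a\<close>, give an
  induction on the number of coefficients that uses one more split per step. Two coefficients
  need a single split, so \<open>p \<ge> 2\<close> coefficients get by with \<open>p - 1\<close> splits once the middle range
  \<open>a \<le> \<eta> < T - a\<close> is settled. There the value of \<open>\<eta>\<close> relative to the sums of two or more
  coefficients decides which 0/1 points lie below the slab and which lie above it, and this
  suggests the splits on partial coordinate sums: one split for three coefficients; for four
  coefficients, two splits if \<open>\<eta> < b + c\<close> (\<open>unit_covers_four_below_middle_pair\<close>) or, by
  reflection, if \<open>\<eta> \<ge> a + d\<close>, and three splits if \<open>b + c \<le> \<eta> < a + d\<close>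
  (\<open>unit_covers_four_central\<close>).

  It remains to see that the offsets in the list suffice: a split with coefficients in
  \<open>{-1, 0, 1}\<close> and at most \<open>k\<close> of them non-zero that meets the cube has its offset between
  \<open>-k\<close> and \<open>k\<close>, and a split that misses the cube can be dropped from any cover.
\<close>

section \<open>Covers by unit splits and the symmetries of the cube\<close>

definition support :: "int ^ 'n \<Rightarrow> 'n set" where
  "support \<pi> = {i. \<pi> $ i \<noteq> 0}"

text \<open>
  The splits are confined to the support of \<open>\<pi>\<close>, so that they inherit its sparsity, but their
  offsets are arbitrary. This keeps the notion invariant under flips, which shift offsets.
\<close>

definition unit_covers :: "nat \<Rightarrow> int ^ 'n \<Rightarrow> int \<Rightarrow> bool" where
  "unit_covers m \<pi> \<eta> \<longleftrightarrow> (\<exists>\<G>. finite \<G> \<and> card \<G> \<le> m \<and> dominates \<G> (split_set \<pi> \<eta>) \<and>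
     (\<forall>U\<in>\<G>. \<exists>\<sigma> \<theta>. U = split_set \<sigma> \<theta> \<and> (\<forall>i. \<sigma> $ i \<in> {-1, 0, 1}) \<and> support \<sigma> \<subseteq> support \<pi>))"

lemma unit_covers_mono: "unit_covers m \<pi> \<eta> \<Longrightarrow> m \<le> m' \<Longrightarrow> unit_covers m' \<pi> \<eta>"
  unfolding unit_covers_def by (meson le_trans)

lemma mem_unit_cube: "x \<in> cbox (0 :: real ^ 'n) 1 \<longleftrightarrow> (\<forall>i. 0 \<le> x $ i \<and> x $ i \<le> 1)"
  by (simp add: mem_box_cart)

lemma inner_eq_sum:
  fixes x :: "real ^ 'n"
  assumes "support \<pi> \<subseteq> A"
  shows "(\<chi> i. of_int (\<pi> $ i)) \<bullet> x = (\<Sum>i\<in>A. of_int (\<pi> $ i) * x $ i)"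
proof -
  have "(\<chi> i. of_int (\<pi> $ i)) \<bullet> x = (\<Sum>i\<in>UNIV. of_int (\<pi> $ i) * x $ i)"
    by (simp add: inner_vec_def)
  also have "\<dots> = (\<Sum>i\<in>A. of_int (\<pi> $ i) * x $ i)"
    using assms by (intro sum.mono_neutral_right) (auto simp: support_def)
  finally show ?thesis .
qed

lemma mem_split_set:
  fixes x :: "real ^ 'n"
  assumes "support \<pi> \<subseteq> A"
  shows "x \<in> split_set \<pi> \<eta> \<longleftrightarrow>
    of_int \<eta> < (\<Sum>i\<in>A. of_int (\<pi> $ i) * x $ i) \<and> (\<Sum>i\<in>A. of_int (\<pi> $ i) * x $ i) < of_int \<eta> + 1"
  using inner_eq_sum[OF assms, of x] by (simp add: split_set_def)

definition flip_point :: "'n set \<Rightarrow> real ^ 'n \<Rightarrow> real ^ 'n" where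
  "flip_point F x = (\<chi> i. if i \<in> F then 1 - x $ i else x $ i)"

definition flip_normal :: "'n set \<Rightarrow> int ^ 'n \<Rightarrow> int ^ 'n" where
  "flip_normal F \<pi> = (\<chi> i. if i \<in> F then - \<pi> $ i else \<pi> $ i)"

lemma flip_point_flip_point: "flip_point F (flip_point F x) = x"
  by (simp add: flip_point_def vec_eq_iff)

lemma flip_point_mem_unit_cube: "flip_point F x \<in> cbox 0 1 \<longleftrightarrow> x \<in> cbox 0 1"
  unfolding mem_unit_cube flip_point_def
  by (intro iff_allI) auto

lemma support_flip_normal: "support (flip_normal F \<pi>) = support \<pi>"
  by (auto simp: support_def flip_normal_def)

lemma flip_point_mem_split_set:
  fixes x :: "real ^ 'n"
  shows "flip_point F x \<in> split_set \<pi> \<eta> \<longleftrightarrow>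
    x \<in> split_set (flip_normal F \<pi>) (\<eta> - (\<Sum>i\<in>F. \<pi> $ i))"
proof -
  have "(\<Sum>i\<in>UNIV. of_int (\<pi> $ i) * flip_point F x $ i) =
      (\<Sum>i\<in>UNIV. of_int (flip_normal F \<pi> $ i) * x $ i + (if i \<in> F then of_int (\<pi> $ i) else 0))"
    by (intro sum.cong) (auto simp: flip_point_def flip_normal_def algebra_simps)
  also have "\<dots> = (\<Sum>i\<in>UNIV. of_int (flip_normal F \<pi> $ i) * x $ i) + of_int (\<Sum>i\<in>F. \<pi> $ i)"
    by (simp add: sum.distrib sum.If_cases)
  finally show ?thesis
    by (simp add: mem_split_set[OF subset_UNIV] less_diff_eq diff_less_eq algebra_simps)
qed

text \<open>
  The flip is an involution of the cube, so the preimages of the splits that cover the flipped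
  slab cover the slab itself.
\<close>

lemma unit_covers_flip:
  assumes "unit_covers m (flip_normal F \<pi>) (\<eta> - (\<Sum>i\<in>F. \<pi> $ i))"
  shows "unit_covers m \<pi> \<eta>"
proof -
  obtain \<G> where G: "finite \<G>" "card \<G> \<le> m"
      "dominates \<G> (split_set (flip_normal F \<pi>) (\<eta> - (\<Sum>i\<in>F. \<pi> $ i)))"
      "\<And>U. U \<in> \<G> \<Longrightarrow> \<exists>\<sigma> \<theta>. U = split_set \<sigma> \<theta> \<and> (\<forall>i. \<sigma> $ i \<in> {-1, 0, 1}) \<and>
        support \<sigma> \<subseteq> support (flip_normal F \<pi>)"
    using assms unfolding unit_covers_def by blast
  let ?H = "(\<lambda>U. flip_point F -` U) ` \<G>"
  have "dominates ?H (split_set \<pi> \<eta>)"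
    unfolding dominates_def
  proof
    fix x assume x: "x \<in> split_set \<pi> \<eta> \<inter> cbox 0 1"
    then have "flip_point F x \<in> split_set (flip_normal F \<pi>) (\<eta> - (\<Sum>i\<in>F. \<pi> $ i)) \<inter> cbox 0 1"
      using flip_point_mem_split_set[of F "flip_point F x" \<pi> \<eta>]
      by (simp add: flip_point_flip_point flip_point_mem_unit_cube)
    then show "x \<in> \<Union>?H \<inter> cbox 0 1"
      using G(3) x unfolding dominates_def by auto
  qed
  moreover have "\<exists>\<sigma> \<theta>. V = split_set \<sigma> \<theta> \<and> (\<forall>i. \<sigma> $ i \<in> {-1, 0, 1}) \<and> support \<sigma> \<subseteq> support \<pi>"
    if V: "V \<in> ?H" for V
  proof -
    from V obtain U where U: "U \<in> \<G>" "V = flip_point F -` U"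
      by (elim imageE) simp
    obtain \<sigma> \<theta> where s: "U = split_set \<sigma> \<theta>" "\<forall>i. \<sigma> $ i \<in> {-1, 0, 1}" "support \<sigma> \<subseteq> support \<pi>"
      using G(4)[OF U(1)] by (auto simp: support_flip_normal)
    have "V = split_set (flip_normal F \<sigma>) (\<theta> - (\<Sum>i\<in>F. \<sigma> $ i))"
      unfolding U(2) s(1) by (simp only: set_eq_iff vimage_eq flip_point_mem_split_set simp_thms)
    moreover have "\<forall>i. flip_normal F \<sigma> $ i \<in> {-1, 0, 1}"
      using s(2) by (auto simp: flip_normal_def)
    ultimately show ?thesis
      using s(3) by (metis support_flip_normal)
  qed
  moreover have "finite ?H" "card ?H \<le> m"
    using G(1,2) card_image_le[OF G(1), of "\<lambda>U. flip_point F -` U"] by auto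
  ultimately show ?thesis
    unfolding unit_covers_def by blast
qed

lemma split_set_uminus: "split_set (- \<pi>) (- \<eta> - 1) = split_set \<pi> \<eta>"
  by (auto simp: split_set_def inner_vec_def sum_negf)

text \<open>
  Flipping all coordinates gives the normal \<open>-\<pi>\<close>; writing the flipped slab with normal \<open>\<pi>\<close>
  again reverses the order of the values \<open>0, \<dots>, T - 1\<close> of \<open>\<eta>\<close>.
\<close>

lemma unit_covers_reflect:
  fixes \<pi> :: "int ^ 'n"
  assumes "unit_covers m \<pi> ((\<Sum>i\<in>support \<pi>. \<pi> $ i) - 1 - \<eta>)"
  shows "unit_covers m \<pi> \<eta>"
proof (rule unit_covers_flip[of m UNIV])
  have "(\<Sum>i\<in>support \<pi>. \<pi> $ i) = (\<Sum>i\<in>UNIV. \<pi> $ i)"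
    by (intro sum.mono_neutral_left) (auto simp: support_def)
  moreover have "flip_normal UNIV \<pi> = - \<pi>"
    by (simp add: flip_normal_def vec_eq_iff)
  moreover have "support (- \<pi>) = support \<pi>"
    by (simp add: support_def)
  moreover have "split_set (- \<pi>) (\<eta> - (\<Sum>i\<in>UNIV. \<pi> $ i)) = split_set \<pi> ((\<Sum>i\<in>UNIV. \<pi> $ i) - 1 - \<eta>)"
    using split_set_uminus[of \<pi> "(\<Sum>i\<in>UNIV. \<pi> $ i) - 1 - \<eta>"] by simp
  ultimately show "unit_covers m (flip_normal UNIV \<pi>) (\<eta> - (\<Sum>i\<in>UNIV. \<pi> $ i))"
    using assms by (simp add: unit_covers_def)
qed

section \<open>Splits on partial coordinate sums\<close>

definition sum_split :: "'n set \<Rightarrow> int \<Rightarrow> (real ^ 'n) set" where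
  "sum_split J t = split_set (\<chi> i. if i \<in> J then 1 else 0) t"

lemma mem_sum_split:
  fixes x :: "real ^ 'n"
  shows "x \<in> sum_split J t \<longleftrightarrow> of_int t < (\<Sum>i\<in>J. x $ i) \<and> (\<Sum>i\<in>J. x $ i) < of_int t + 1"
proof -
  have "support (\<chi> i. if i \<in> J then 1 else 0) \<subseteq> J"
    by (auto simp: support_def)
  from mem_split_set[OF this, of x t] show ?thesis
    by (simp add: sum_split_def)
qed

lemma unit_covers_sum_splits:
  assumes "\<And>J t. (J, t) \<in> set js \<Longrightarrow> J \<subseteq> support \<pi>"
    and "\<And>x. x \<in> cbox 0 1 \<Longrightarrow> x \<in> split_set \<pi> \<eta> \<Longrightarrow> \<exists>(J, t) \<in> set js. x \<in> sum_split J t"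
  shows "unit_covers (length js) \<pi> \<eta>"
proof -
  let ?G = "(\<lambda>(J, t). sum_split J t) ` set js"
  have "dominates ?G (split_set \<pi> \<eta>)"
    unfolding dominates_def using assms(2) by fastforce
  moreover have "card ?G \<le> length js"
    by (meson card_image_le card_length le_trans List.finite_set)
  moreover have "\<exists>\<sigma> \<theta>. U = split_set \<sigma> \<theta> \<and> (\<forall>i. \<sigma> $ i \<in> {-1, 0, 1}) \<and> support \<sigma> \<subseteq> support \<pi>"
    if U: "U \<in> ?G" for U
  proof -
    from U obtain jt where "jt \<in> set js" "U = (case jt of (J, t) \<Rightarrow> sum_split J t)"
      by (elim imageE)
    then have J: "(fst jt, snd jt) \<in> set js" "U = sum_split (fst jt) (snd jt)"
      by (simp_all add: case_prod_beta)
    show ?thesis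
      using assms(1)[OF J(1)] unfolding J(2) sum_split_def
      by (intro exI[of _ "\<chi> i. if i \<in> fst jt then 1 else 0"] exI[of _ "snd jt"]) (auto simp: support_def)
  qed
  ultimately show ?thesis
    unfolding unit_covers_def by (intro exI[of _ ?G]) simp
qed

lemma unit_covers_empty_support:
  assumes "support \<pi> = {}"
  shows "unit_covers 0 \<pi> \<eta>"
proof -
  have "split_set \<pi> \<eta> = {}"
    using mem_split_set[of \<pi> "{}"] assms by auto
  then show ?thesis
    unfolding unit_covers_def dominates_def by (intro exI[of _ "{}"]) auto
qed

text \<open>
  On the slab \<open>x\<^sub>p = 1\<close> would force a value of at least \<open>\<pi>\<^sub>p \<ge> \<eta> + 1\<close>. So \<open>0 < x\<^sub>p < 1\<close> covers
  all of the slab but its part in the face \<open>x\<^sub>p = 0\<close>, which is a slab in the other coordinates.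
\<close>

lemma unit_covers_drop_coordinate:
  fixes \<pi> :: "int ^ 'n"
  assumes nonneg: "\<And>i. 0 \<le> \<pi> $ i" and p: "0 < \<pi> $ p" "\<eta> < \<pi> $ p"
    and rest: "unit_covers m (\<chi> i. if i = p then 0 else \<pi> $ i) \<eta>"
  shows "unit_covers (Suc m) \<pi> \<eta>"
proof -
  let ?\<rho> = "\<chi> i. if i = p then 0 else \<pi> $ i"
  obtain \<G> where G: "finite \<G>" "card \<G> \<le> m" "dominates \<G> (split_set ?\<rho> \<eta>)"
      "\<And>U. U \<in> \<G> \<Longrightarrow> \<exists>\<sigma> \<theta>. U = split_set \<sigma> \<theta> \<and> (\<forall>i. \<sigma> $ i \<in> {-1, 0, 1}) \<and> support \<sigma> \<subseteq> support ?\<rho>"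
    using rest unfolding unit_covers_def by blast
  have "dominates (insert (sum_split {p} 0) \<G>) (split_set \<pi> \<eta>)"
    unfolding dominates_def
  proof
    fix x assume "x \<in> split_set \<pi> \<eta> \<inter> cbox 0 1"
    then have x: "x \<in> split_set \<pi> \<eta>" "x \<in> cbox 0 1" and x01: "\<And>i. 0 \<le> x $ i" "\<And>i. x $ i \<le> 1"
      by (simp_all add: mem_unit_cube)
    have split: "(\<Sum>i\<in>UNIV. of_int (\<pi> $ i) * x $ i) =
        of_int (\<pi> $ p) * x $ p + (\<Sum>i\<in>UNIV. of_int (?\<rho> $ i) * x $ i)"
    proof -
      have "(\<Sum>i\<in>UNIV. of_int (?\<rho> $ i) * x $ i) = (\<Sum>i\<in>UNIV - {p}. of_int (\<pi> $ i) * x $ i)"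
        by (intro sum.mono_neutral_cong_right) auto
      then show ?thesis
        by (simp add: sum.remove[of UNIV p])
    qed
    have "x $ p < 1"
    proof (rule ccontr)
      assume "\<not> x $ p < 1"
      then have "x $ p = 1"
        using x01(2)[of p] by simp
      moreover have "0 \<le> (\<Sum>i\<in>UNIV. of_int (?\<rho> $ i) * x $ i)"
        using nonneg x01(1) by (intro sum_nonneg) auto
      moreover have "of_int \<eta> + 1 \<le> (of_int (\<pi> $ p) :: real)"
        using p(2) by linarith
      ultimately show False
        using x(1) split by (simp add: mem_split_set[OF subset_UNIV])
    qed
    moreover have "x \<in> split_set ?\<rho> \<eta>" if "x $ p = 0"
      using x(1) split that by (simp add: mem_split_set[OF subset_UNIV])
    moreover have "0 \<le> x $ p"
      by (rule x01)
    ultimately show "x \<in> \<Union>(insert (sum_split {p} 0) \<G>) \<inter> cbox 0 1"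
      using G(3) x(2) unfolding dominates_def
      by (cases "x $ p = 0") (auto simp: mem_sum_split)
  qed
  moreover have "\<exists>\<sigma> \<theta>. U = split_set \<sigma> \<theta> \<and> (\<forall>i. \<sigma> $ i \<in> {-1, 0, 1}) \<and> support \<sigma> \<subseteq> support \<pi>"
    if U: "U \<in> insert (sum_split {p} 0) \<G>" for U
  proof (cases "U \<in> \<G>")
    case True
    moreover have "support ?\<rho> \<subseteq> support \<pi>"
      by (auto simp: support_def)
    ultimately show ?thesis
      using G(4) by (meson subset_trans)
  next
    case False
    then show ?thesis
      using U p(1) unfolding sum_split_def
      by (intro exI[of _ "\<chi> i. if i \<in> {p} then 1 else 0"] exI[of _ 0]) (auto simp: support_def)
  qed
  moreover have "card (insert (sum_split {p} 0) \<G>) \<le> Suc m"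
    using G(1,2) by (simp add: card_insert_if)
  ultimately show ?thesis
    unfolding unit_covers_def using G(1) by (meson finite_insert)
qed

section \<open>Slabs with at most four positive coefficients\<close>

lemma pos_of_mem_support:
  assumes "\<And>i. 0 \<le> \<pi> $ i" "i \<in> support \<pi>"
  shows "0 < \<pi> $ i"
  using assms(1)[of i] assms(2) by (simp add: support_def order_less_le)

lemma unit_covers_one:
  fixes \<pi> :: "int ^ 'n"
  assumes nonneg: "\<And>i. 0 \<le> \<pi> $ i" and supp: "support \<pi> = {p}"
  shows "unit_covers 1 \<pi> \<eta>"
proof -
  have pos: "0 < \<pi> $ p"
    by (rule pos_of_mem_support[OF nonneg]) (simp add: supp)
  have low: "unit_covers 1 \<pi> \<eta>" if "\<eta> < \<pi> $ p" for \<eta>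
  proof -
    have "support (\<chi> i. if i = p then 0 else \<pi> $ i) = {}"
      using supp by (auto simp: support_def)
    from unit_covers_drop_coordinate[OF nonneg pos that unit_covers_empty_support[OF this]]
    show ?thesis by simp
  qed
  show ?thesis
  proof (cases "\<eta> < \<pi> $ p")
    case False
    then have "(\<Sum>i\<in>support \<pi>. \<pi> $ i) - 1 - \<eta> < \<pi> $ p"
      using pos by (simp add: supp)
    then show ?thesis
      by (rule unit_covers_reflect[OF low])
  qed (rule low)
qed

text \<open>
  With coefficients \<open>a \<ge> b\<close>, dropping a coordinate would cost a second split. If \<open>\<eta> < b\<close>, the slab lies
  in the corner \<open>0 < x + y < 1\<close>; if \<open>\<eta> \<ge> a\<close>, in the opposite corner; and in between it meets
  neither \<open>x = 0\<close>, where the value is at most \<open>b\<close>, nor \<open>x = 1\<close>, where it is at least \<open>a\<close>.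
\<close>

lemma unit_covers_two:
  fixes \<pi> :: "int ^ 'n"
  assumes nonneg: "\<And>i. 0 \<le> \<pi> $ i" and supp: "support \<pi> = {p, q}" and pq: "p \<noteq> q"
    and ord: "\<pi> $ q \<le> \<pi> $ p"
  shows "unit_covers 1 \<pi> \<eta>"
proof -
  have pos: "0 < \<pi> $ p" "0 < \<pi> $ q"
    by (intro pos_of_mem_support[OF nonneg]; simp add: supp)+
  define a b where "a = (of_int (\<pi> $ p) :: real)" and "b = (of_int (\<pi> $ q) :: real)"
  have ab: "0 < b" "b \<le> a"
    using pos ord by (auto simp: a_def b_def)
  have mem: "x \<in> split_set \<pi> \<eta> \<longleftrightarrow>
      of_int \<eta> < a * x $ p + b * x $ q \<and> a * x $ p + b * x $ q < of_int \<eta> + 1" for x \<eta>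
    using pq by (simp add: mem_split_set[OF eq_refl[OF supp]] a_def b_def)
  have low: "unit_covers 1 \<pi> \<eta>" if "\<eta> < \<pi> $ q" for \<eta>
  proof -
    have eta: "of_int \<eta> + 1 \<le> b"
      using that unfolding b_def by linarith
    have "x \<in> sum_split {p, q} 0" if x: "x \<in> cbox 0 1" "x \<in> split_set \<pi> \<eta>" for x
    proof -
      have x01: "0 \<le> x $ p" "0 \<le> x $ q"
        using x(1) by (simp_all add: mem_unit_cube)
      have v: "of_int \<eta> < a * x $ p + b * x $ q" "a * x $ p + b * x $ q < b"
        using x(2) eta by (auto simp: mem)
      have "b * x $ p \<le> a * x $ p"
        using ab x01 by (intro mult_right_mono)
      then have "b * (x $ p + x $ q) < b * 1"
        using v by (simp add: distrib_left)
      then have "x $ p + x $ q < 1"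
        using ab by simp
      moreover have "x $ p + x $ q \<noteq> 0"
      proof
        assume "x $ p + x $ q = 0"
        then have "x $ p = 0" "x $ q = 0"
          using x01 by linarith+
        then show False
          using x(2) by (auto simp: mem)
      qed
      ultimately show ?thesis
        using pq x01 by (simp add: mem_sum_split)
    qed
    then show ?thesis
      using unit_covers_sum_splits[of "[({p, q}, 0)]" \<pi> \<eta>] supp by simp
  qed
  consider "\<eta> < \<pi> $ q" | "\<pi> $ q \<le> \<eta>" "\<eta> < \<pi> $ p" | "\<pi> $ p \<le> \<eta>"
    by linarith
  then show ?thesis
  proof cases
    case 1
    then show ?thesis by (rule low)
  next
    case 2
    have eta: "of_int \<eta> + 1 \<le> a" "b \<le> of_int \<eta>"
      using 2 unfolding a_def b_def by linarith+
    have "x \<in> sum_split {p} 0" if x: "x \<in> cbox 0 1" "x \<in> split_set \<pi> \<eta>" for x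
    proof -
      have x01: "0 \<le> x $ p" "0 \<le> x $ q" "x $ p \<le> 1" "x $ q \<le> 1"
        using x(1) by (simp_all add: mem_unit_cube)
      have "0 \<le> b * x $ q" "b * x $ q \<le> b * 1"
        using ab x01 by (auto intro: mult_left_mono)
      then have "x $ p \<noteq> 0" "x $ p \<noteq> 1"
        using x(2) eta by (auto simp: mem)
      then show ?thesis
        using x01 by (simp add: mem_sum_split)
    qed
    then show ?thesis
      using unit_covers_sum_splits[of "[({p}, 0)]" \<pi> \<eta>] supp by simp
  next
    case 3
    then have "(\<Sum>i\<in>support \<pi>. \<pi> $ i) - 1 - \<eta> < \<pi> $ q"
      using pq by (simp add: supp)
    then show ?thesis
      by (rule unit_covers_reflect[OF low])
  qed
qed

text \<open>
  In the middle range \<open>a \<le> \<eta> < b + c\<close> every single coefficient is at most \<open>\<eta>\<close> and every sum of two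
  is at least \<open>\<eta> + 1\<close>. So the slab separates the 0/1 points with at most one 1 from those with
  at least two, and \<open>1 < x + y + z < 2\<close> contains it.
\<close>

lemma unit_covers_three:
  fixes \<pi> :: "int ^ 'n"
  assumes nonneg: "\<And>i. 0 \<le> \<pi> $ i" and supp: "support \<pi> = {p, q, r}" and dist: "distinct [p, q, r]"
    and ord: "\<pi> $ q \<le> \<pi> $ p" "\<pi> $ r \<le> \<pi> $ q"
  shows "unit_covers 2 \<pi> \<eta>"
proof -
  have ne: "p \<noteq> q" "p \<noteq> r" "q \<noteq> r"
    using dist by auto
  have pos: "0 < \<pi> $ p" "0 < \<pi> $ q" "0 < \<pi> $ r"
    by (intro pos_of_mem_support[OF nonneg]; simp add: supp)+
  have low: "unit_covers 2 \<pi> \<eta>" if "\<eta> < \<pi> $ p" for \<eta>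
  proof -
    let ?\<rho> = "\<chi> i. if i = p then 0 else \<pi> $ i"
    have "support ?\<rho> = support \<pi> - {p}"
      by (auto simp: support_def)
    then have "support ?\<rho> = {q, r}"
      using supp ne by auto
    then have "unit_covers 1 ?\<rho> \<eta>"
      using nonneg ord ne by (intro unit_covers_two[of _ q r]) auto
    from unit_covers_drop_coordinate[OF nonneg pos(1) that this] show ?thesis
      by (simp add: numeral_2_eq_2)
  qed
  consider "\<eta> < \<pi> $ p" | "\<pi> $ p \<le> \<eta>" "\<eta> < \<pi> $ q + \<pi> $ r" | "\<pi> $ q + \<pi> $ r \<le> \<eta>"
    by linarith
  then show ?thesis
  proof cases
    case 1
    then show ?thesis by (rule low)
  next
    case 2
    define a b c where abc_def: "a = (of_int (\<pi> $ p) :: real)" "b = (of_int (\<pi> $ q) :: real)"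
      "c = (of_int (\<pi> $ r) :: real)"
    have abc: "0 < c" "c \<le> b" "b \<le> a"
      using pos ord by (auto simp: abc_def)
    have eta: "a \<le> of_int \<eta>" "of_int \<eta> + 1 \<le> b + c"
      using 2 unfolding abc_def by linarith+
    have "x \<in> sum_split {p, q, r} 1" if x: "x \<in> cbox 0 1" "x \<in> split_set \<pi> \<eta>" for x
    proof -
      have x01: "0 \<le> x $ p" "0 \<le> x $ q" "0 \<le> x $ r" "x $ r \<le> 1"
        using x(1) by (simp_all add: mem_unit_cube)
      have v: "a < a * x $ p + b * x $ q + c * x $ r" "a * x $ p + b * x $ q + c * x $ r < b + c"
        using x(2) eta ne by (auto simp: mem_split_set[OF eq_refl[OF supp]] abc_def add.assoc)
      have "b * x $ q \<le> a * x $ q" "c * x $ r \<le> a * x $ r"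
        using abc x01 by (auto intro!: mult_right_mono)
      then have "a * 1 < a * (x $ p + x $ q + x $ r)"
        using v by (simp add: distrib_left)
      then have gt1: "1 < x $ p + x $ q + x $ r"
        using abc by (simp only: mult_less_cancel_left_pos)
      have "b * x $ p \<le> a * x $ p"
        using abc x01 by (intro mult_right_mono)
      moreover have "(b - c) * x $ r \<le> (b - c) * 1"
        using abc x01 by (intro mult_left_mono) auto
      ultimately have "b * (x $ p + x $ q + x $ r) < b * 2"
        using v by (simp add: algebra_simps)
      then have "x $ p + x $ q + x $ r < 2"
        using abc by (simp only: mult_less_cancel_left_pos)
      with gt1 show ?thesis
        using ne by (simp add: mem_sum_split add.assoc)
    qed
    then have "unit_covers 1 \<pi> \<eta>"
      using unit_covers_sum_splits[of "[({p, q, r}, 1)]" \<pi> \<eta>] supp by simp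
    then show ?thesis
      by (rule unit_covers_mono) simp
  next
    case 3
    then have "(\<Sum>i\<in>support \<pi>. \<pi> $ i) - 1 - \<eta> < \<pi> $ p"
      using ne by (simp add: supp)
    then show ?thesis
      by (rule unit_covers_reflect[OF low])
  qed
qed


context
  fixes \<pi> :: "int ^ 'n" and p q r s :: 'n
  assumes nonneg: "\<And>i. 0 \<le> \<pi> $ i" and supp: "support \<pi> = {p, q, r, s}"
    and dist: "distinct [p, q, r, s]"
    and ord: "\<pi> $ q \<le> \<pi> $ p" "\<pi> $ r \<le> \<pi> $ q" "\<pi> $ s \<le> \<pi> $ r"
begin

lemma four_distinct: "p \<noteq> q" "p \<noteq> r" "p \<noteq> s" "q \<noteq> r" "q \<noteq> s" "r \<noteq> s"
  using dist by auto

lemma four_mem_split_set: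
  "x \<in> split_set \<pi> \<eta> \<longleftrightarrow>
    of_int \<eta> < of_int (\<pi> $ p) * x $ p + of_int (\<pi> $ q) * x $ q + of_int (\<pi> $ r) * x $ r + of_int (\<pi> $ s) * x $ s \<and>
    of_int (\<pi> $ p) * x $ p + of_int (\<pi> $ q) * x $ q + of_int (\<pi> $ r) * x $ r + of_int (\<pi> $ s) * x $ s < of_int \<eta> + 1"
  using four_distinct by (simp add: mem_split_set[OF eq_refl[OF supp]] add.assoc)

lemma four_pos: "0 < \<pi> $ p" "0 < \<pi> $ q" "0 < \<pi> $ r" "0 < \<pi> $ s"
  by (intro pos_of_mem_support[OF nonneg]; simp add: supp)+

lemma unit_covers_four_below_largest:
  assumes "\<eta> < \<pi> $ p"
  shows "unit_covers 3 \<pi> \<eta>"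
proof -
  let ?\<rho> = "\<chi> i. if i = p then 0 else \<pi> $ i"
  have "support ?\<rho> = support \<pi> - {p}"
    by (auto simp: support_def)
  also have "\<dots> = {q, r, s}"
    unfolding supp using four_distinct by blast
  finally have "support ?\<rho> = {q, r, s}" .
  then have "unit_covers 2 ?\<rho> \<eta>"
    using nonneg ord four_distinct by (intro unit_covers_three[of _ q r s]) auto
  from unit_covers_drop_coordinate[OF nonneg four_pos(1) assms this] show ?thesis
    by (simp add: numeral_3_eq_3)
qed

text \<open>
  Here \<open>x\<^sub>1 + x\<^sub>2 + x\<^sub>3 \<ge> 2\<close> would force a value of at least \<open>b + c \<ge> \<eta> + 1\<close>, so the split
  \<open>1 < x\<^sub>1 + x\<^sub>2 + x\<^sub>3 < 2\<close> leaves only the points with \<open>x\<^sub>1 + x\<^sub>2 + x\<^sub>3 \<le> 1\<close>. Among the 0/1 points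
  satisfying this, those above the slab have \<open>x\<^sub>4 = 1\<close> and \<open>x\<^sub>i = 1\<close> for some \<open>i \<in> {1, 2, 3}\<close>
  whose coefficient together with \<open>d\<close> exceeds \<open>\<eta>\<close>. If \<open>J\<close> is the set of these \<open>i\<close>, the 0/1 points
  above the slab are those with \<open>x(J) + x\<^sub>4 = 2\<close>, which leads to the second split
  \<open>1 < x(J) + x\<^sub>4 < 2\<close>. The set \<open>J\<close> depends on \<open>\<eta>\<close>, and it may be empty.
\<close>

lemma unit_covers_four_below_middle_pair:
  assumes ge: "\<pi> $ p \<le> \<eta>" and less: "\<eta> < \<pi> $ q + \<pi> $ r"
  shows "unit_covers 2 \<pi> \<eta>"
proof -
  note ne = four_distinct
  define a b c d where abcd_def: "a = (of_int (\<pi> $ p) :: real)" "b = (of_int (\<pi> $ q) :: real)"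
    "c = (of_int (\<pi> $ r) :: real)" "d = (of_int (\<pi> $ s) :: real)"
  have abcd: "0 < d" "d \<le> c" "c \<le> b" "b \<le> a"
    using four_pos ord by (simp_all add: abcd_def)
  have eta: "a \<le> of_int \<eta>" "of_int \<eta> + 1 \<le> b + c"
    using ge less unfolding abcd_def by linarith+
  define J where "J = {i \<in> {p, q, r}. \<eta> < \<pi> $ i + \<pi> $ s}"
  define K where "K = {p, q, r} - J"
  have J: "J \<subseteq> {p, q, r}" "finite J" "s \<notin> J"
    using ne by (auto simp: J_def)
  have J_coeff: "of_int \<eta> + 1 - d \<le> of_int (\<pi> $ i)" if "i \<in> J" for i
  proof -
    have "\<eta> + 1 \<le> \<pi> $ i + \<pi> $ s"
      using that by (simp add: J_def)
    then show ?thesis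
      unfolding abcd_def by linarith
  qed
  have K_coeff: "of_int (\<pi> $ i) \<le> of_int \<eta> - d" if "i \<in> K" for i
  proof -
    have "\<pi> $ i + \<pi> $ s \<le> \<eta>"
      using that by (auto simp: J_def K_def)
    then show ?thesis
      unfolding abcd_def by linarith
  qed
  have total: "f p + f q + f r = sum f J + sum f K" for f :: "'n \<Rightarrow> real"
  proof -
    have "sum f {p, q, r} = sum f K + sum f J"
      unfolding K_def by (rule sum.subset_diff[OF J(1)]) simp
    then show ?thesis
      using ne by (simp add: add.assoc)
  qed
  have "x \<in> sum_split {p, q, r} 1 \<or> x \<in> sum_split (insert s J) 1"
    if x: "x \<in> cbox 0 1" "x \<in> split_set \<pi> \<eta>" for x
  proof -
    have x01: "0 \<le> x $ i" "x $ i \<le> 1" for i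
      using x(1) by (simp_all add: mem_unit_cube)
    have v: "of_int \<eta> < a * x $ p + b * x $ q + c * x $ r + d * x $ s"
      "a * x $ p + b * x $ q + c * x $ r + d * x $ s < of_int \<eta> + 1"
      using x(2) by (simp_all add: four_mem_split_set abcd_def)
    have "b * x $ p \<le> a * x $ p"
      using abcd x01 by (intro mult_right_mono)
    moreover have "(b - c) * x $ r \<le> (b - c) * 1"
      using abcd x01 by (intro mult_left_mono) simp_all
    moreover have "0 \<le> d * x $ s"
      using abcd x01 by simp
    ultimately have "b * (x $ p + x $ q + x $ r) < b * 2"
      using v eta by (simp add: algebra_simps)
    then have lt2: "x $ p + x $ q + x $ r < 2"
      using abcd by (simp only: mult_less_cancel_left_pos)
    show ?thesis
    proof (cases "1 < x $ p + x $ q + x $ r")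
      case True
      then show ?thesis
        using lt2 ne by (simp add: mem_sum_split add.assoc)
    next
      case False
      define y z where "y = (\<Sum>i\<in>J. x $ i)" and "z = (\<Sum>i\<in>K. x $ i)"
      have yz: "y + z \<le> 1" "0 \<le> z"
        using False total[of "\<lambda>i. x $ i"] x01 by (simp_all add: y_def z_def sum_nonneg)
      define Y Z where "Y = (\<Sum>i\<in>J. of_int (\<pi> $ i) * x $ i)" and "Z = (\<Sum>i\<in>K. of_int (\<pi> $ i) * x $ i)"
      have val: "a * x $ p + b * x $ q + c * x $ r = Y + Z"
        using total[of "\<lambda>i. of_int (\<pi> $ i) * x $ i"] by (simp add: abcd_def Y_def Z_def)
      \<comment> \<open>Each coefficient is at most \<open>\<eta>\<close>, and those in \<open>K\<close> are at most \<open>\<eta> - d\<close>. So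
        \<open>x\<^sub>4 \<le> 1 - y\<close> and \<open>z \<le> 1 - y\<close> bound the value by \<open>\<eta> y + (\<eta> - d) (1 - y) + d (1 - y) = \<eta>\<close>.\<close>
      have "1 < y + x $ s"
      proof (rule ccontr)
        assume "\<not> 1 < y + x $ s"
        then have xs: "x $ s \<le> 1 - y"
          by simp
        have "of_int (\<pi> $ i) \<le> (of_int \<eta> :: real)" if "i \<in> J" for i
          using that J(1) ge ord by auto
        then have "Y \<le> of_int \<eta> * y"
          unfolding Y_def y_def sum_distrib_left using x01
          by (intro sum_mono mult_right_mono)
        moreover have "Z \<le> (of_int \<eta> - d) * z"
          unfolding Z_def z_def sum_distrib_left using x01 K_coeff
          by (intro sum_mono mult_right_mono)
        moreover have "(of_int \<eta> - d) * z \<le> (of_int \<eta> - d) * (1 - y)"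
          using eta abcd yz by (intro mult_left_mono) linarith+
        moreover have "d * x $ s \<le> d * (1 - y)"
          using abcd xs by (intro mult_left_mono) linarith+
        ultimately show False
          using v(1) unfolding val by (simp add: algebra_simps)
      qed
      \<comment> \<open>Otherwise \<open>x\<^sub>4 = 1\<close> and \<open>y = 1\<close>, and the coefficients in \<open>J\<close> are at least \<open>\<eta> + 1 - d\<close>.\<close>
      moreover have "y + x $ s < 2"
      proof (rule ccontr)
        assume "\<not> y + x $ s < 2"
        then have eq: "y = 1" "x $ s = 1"
          using yz x01(2)[of s] by linarith+
        have "(of_int \<eta> + 1 - d) * y \<le> Y"
          unfolding Y_def y_def sum_distrib_left using x01 J_coeff
          by (intro sum_mono mult_right_mono)
        moreover have "0 \<le> Z"
          unfolding Z_def using nonneg x01 by (simp add: sum_nonneg)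
        ultimately show False
          using v(2) unfolding val by (simp add: eq)
      qed
      ultimately show ?thesis
        using J by (simp add: mem_sum_split y_def add.commute)
    qed
  qed
  moreover have "insert s J \<subseteq> {p, q, r, s}"
    using J(1) by blast
  ultimately show ?thesis
    using unit_covers_sum_splits[of "[({p, q, r}, 1), (insert s J, 1)]" \<pi> \<eta>]
    by (fastforce simp: supp numeral_2_eq_2)
qed

text \<open>
  The first split \<open>0 < x\<^sub>1 < 1\<close> leaves the two faces of the cube. On \<open>x\<^sub>1 = 0\<close> the slab separates the
  0/1 point \<open>(1, 1, 1)\<close> of the remaining coordinates from all others, whose value is at most
  \<open>b + c \<le> \<eta>\<close>; so it lies in \<open>2 < x\<^sub>2 + x\<^sub>3 + x\<^sub>4 < 3\<close>. On \<open>x\<^sub>1 = 1\<close> it separates the point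
  \<open>(0, 0, 0)\<close>, of value \<open>a \<le> \<eta>\<close>, from all others, whose value is at least \<open>a + d \<ge> \<eta> + 1\<close>; so it
  lies in \<open>0 < x\<^sub>2 + x\<^sub>3 + x\<^sub>4 < 1\<close>.
\<close>

lemma unit_covers_four_central:
  assumes ge: "\<pi> $ p \<le> \<eta>" "\<pi> $ q + \<pi> $ r \<le> \<eta>"
    and less: "\<eta> < \<pi> $ p + \<pi> $ s" "\<eta> < \<pi> $ q + \<pi> $ r + \<pi> $ s"
  shows "unit_covers 3 \<pi> \<eta>"
proof -
  note ne = four_distinct
  define a b c d where abcd_def: "a = (of_int (\<pi> $ p) :: real)" "b = (of_int (\<pi> $ q) :: real)"
    "c = (of_int (\<pi> $ r) :: real)" "d = (of_int (\<pi> $ s) :: real)"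
  have abcd: "0 < d" "d \<le> c" "c \<le> b" "b \<le> a"
    using four_pos ord by (simp_all add: abcd_def)
  have eta: "a \<le> of_int \<eta>" "b + c \<le> of_int \<eta>" "of_int \<eta> + 1 \<le> a + d" "of_int \<eta> + 1 \<le> b + c + d"
    using ge less unfolding abcd_def by linarith+
  have "x \<in> sum_split {p} 0 \<or> x \<in> sum_split {q, r, s} 0 \<or> x \<in> sum_split {q, r, s} 2"
    if x: "x \<in> cbox 0 1" "x \<in> split_set \<pi> \<eta>" for x
  proof -
    have x01: "0 \<le> x $ i" "x $ i \<le> 1" for i
      using x(1) by (simp_all add: mem_unit_cube)
    have v: "of_int \<eta> < a * x $ p + b * x $ q + c * x $ r + d * x $ s"
      "a * x $ p + b * x $ q + c * x $ r + d * x $ s < of_int \<eta> + 1"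
      using x(2) by (simp_all add: four_mem_split_set abcd_def)
    consider "0 < x $ p \<and> x $ p < 1" | "x $ p = 0" | "x $ p = 1"
      using x01[of p] by linarith
    then show ?thesis
    proof cases
      case 1
      then show ?thesis
        by (simp add: mem_sum_split)
    next
      case 2
      have "d * x $ s \<le> c * x $ s"
        using abcd x01 by (intro mult_right_mono)
      moreover have "(b - c) * x $ q \<le> (b - c) * 1"
        using abcd x01 by (intro mult_left_mono) simp_all
      ultimately have "c * 2 < c * (x $ q + x $ r + x $ s)"
        using v(1) eta 2 by (simp add: algebra_simps)
      then have "2 < x $ q + x $ r + x $ s"
        using abcd by (simp only: mult_less_cancel_left_pos)
      moreover have "x $ q + x $ r + x $ s < 3"
      proof (rule ccontr)
        assume "\<not> x $ q + x $ r + x $ s < 3"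
        then have "x $ q = 1" "x $ r = 1" "x $ s = 1"
          using x01(2)[of q] x01(2)[of r] x01(2)[of s] by linarith+
        then show False
          using v(2) eta 2 by simp
      qed
      ultimately show ?thesis
        using ne by (simp add: mem_sum_split add.assoc)
    next
      case 3
      have "d * x $ r \<le> c * x $ r" "d * x $ q \<le> b * x $ q"
        using abcd x01 by (simp_all add: mult_right_mono)
      then have "d * (x $ q + x $ r + x $ s) < d * 1"
        using v(2) eta 3 by (simp add: algebra_simps)
      then have "x $ q + x $ r + x $ s < 1"
        using abcd by (simp only: mult_less_cancel_left_pos)
      moreover have "0 < x $ q + x $ r + x $ s"
      proof (rule ccontr)
        assume "\<not> 0 < x $ q + x $ r + x $ s"
        then have "x $ q = 0" "x $ r = 0" "x $ s = 0"
          using x01(1)[of q] x01(1)[of r] x01(1)[of s] by linarith+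
        then show False
          using v(1) eta 3 by simp
      qed
      ultimately show ?thesis
        using ne by (simp add: mem_sum_split add.assoc)
    qed
  qed
  then show ?thesis
    using unit_covers_sum_splits[of "[({p}, 0), ({q, r, s}, 0), ({q, r, s}, 2)]" \<pi> \<eta>]
    by (auto simp: supp numeral_3_eq_3)
qed

lemma unit_covers_four: "unit_covers 3 \<pi> \<eta>"
proof -
  have T: "(\<Sum>i\<in>support \<pi>. \<pi> $ i) = \<pi> $ p + \<pi> $ q + \<pi> $ r + \<pi> $ s"
    using four_distinct by (simp add: supp)
  have mid: "unit_covers 3 \<pi> \<eta>" if "\<pi> $ p \<le> \<eta>" "\<eta> < \<pi> $ q + \<pi> $ r" for \<eta>
    by (rule unit_covers_mono[OF unit_covers_four_below_middle_pair[OF that]]) simp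
  consider "\<eta> < \<pi> $ p" | "\<pi> $ p \<le> \<eta>" "\<eta> < \<pi> $ q + \<pi> $ r"
    | "\<pi> $ p \<le> \<eta>" "\<pi> $ q + \<pi> $ r \<le> \<eta>" "\<eta> < \<pi> $ p + \<pi> $ s" "\<eta> < \<pi> $ q + \<pi> $ r + \<pi> $ s"
    | "\<pi> $ p + \<pi> $ s \<le> \<eta>" "\<eta> < \<pi> $ q + \<pi> $ r + \<pi> $ s"
    | "\<pi> $ q + \<pi> $ r + \<pi> $ s \<le> \<eta>"
    by linarith
  then show ?thesis
  proof cases
    case 1
    then show ?thesis
      by (rule unit_covers_four_below_largest)
  next
    case 2
    then show ?thesis
      by (rule mid)
  next
    case 3
    then show ?thesis
      by (rule unit_covers_four_central)
  next
    case 4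
    \<comment> \<open>The reflection maps this range of \<open>\<eta>\<close> to that of the second case.\<close>
    then have "\<pi> $ p \<le> (\<Sum>i\<in>support \<pi>. \<pi> $ i) - 1 - \<eta>" "(\<Sum>i\<in>support \<pi>. \<pi> $ i) - 1 - \<eta> < \<pi> $ q + \<pi> $ r"
      unfolding T by linarith+
    then show ?thesis
      by (rule unit_covers_reflect[OF mid])
  next
    case 5
    then have "(\<Sum>i\<in>support \<pi>. \<pi> $ i) - 1 - \<eta> < \<pi> $ p"
      unfolding T by linarith
    then show ?thesis
      by (rule unit_covers_reflect[OF unit_covers_four_below_largest])
  qed
qed

end

section \<open>From covers to the covering number\<close>

lemma obtain_sorted_support:
  fixes \<pi> :: "int ^ 'n"
  obtains xs where "distinct xs" "set xs = support \<pi>" "length xs = nnz \<pi>"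
    "sorted_wrt (\<lambda>i j. \<pi> $ j \<le> \<pi> $ i) xs"
proof -
  obtain ys where ys: "set ys = support \<pi>" "distinct ys"
    using finite_distinct_list[of "support \<pi>"] by auto
  let ?xs = "sort_key (\<lambda>i. - \<pi> $ i) ys"
  have "sorted (map (\<lambda>i. - \<pi> $ i) ?xs)"
    by (rule sorted_sort_key)
  then have "sorted_wrt (\<lambda>i j. \<pi> $ j \<le> \<pi> $ i) ?xs"
    by (simp add: sorted_map)
  moreover have "length ?xs = nnz \<pi>"
    using ys distinct_card[of ys] by (simp add: nnz_def support_def)
  ultimately show ?thesis
    using ys that[of ?xs] by simp
qed

lemma unit_covers_nonneg:
  fixes \<pi> :: "int ^ 'n"
  assumes nonneg: "\<And>i. 0 \<le> \<pi> $ i" and k: "k \<in> {2, 3, 4}" and nnz: "nnz \<pi> \<le> k"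
  shows "unit_covers (k - 1) \<pi> \<eta>"
proof -
  obtain xs where xs: "distinct xs" "set xs = support \<pi>" "length xs = nnz \<pi>"
    "sorted_wrt (\<lambda>i j. \<pi> $ j \<le> \<pi> $ i) xs"
    by (rule obtain_sorted_support)
  have "length xs \<le> 4"
    using nnz k xs(3) by auto
  then consider "xs = []" | p where "xs = [p]" | p q where "xs = [p, q]" | p q r where "xs = [p, q, r]"
    | p q r s where "xs = [p, q, r, s]"
    by (auto simp: le_Suc_eq length_Suc_conv numeral_eq_Suc)
  then have "\<exists>m \<le> k - 1. unit_covers m \<pi> \<eta>"
  proof cases
    case 1
    then show ?thesis
      using unit_covers_empty_support[of \<pi> \<eta>] xs(2) by auto
  next
    case (2 p)
    then show ?thesis
      using unit_covers_one[OF nonneg, of p \<eta>] xs(2) k by (intro exI[of _ 1]) auto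
  next
    case (3 p q)
    then show ?thesis
      using unit_covers_two[OF nonneg, of p q \<eta>] xs k by (intro exI[of _ 1]) auto
  next
    case (4 p q r)
    then show ?thesis
      using unit_covers_three[OF nonneg, of p q r \<eta>] xs k nnz by (intro exI[of _ 2]) auto
  next
    case (5 p q r s)
    then show ?thesis
      using unit_covers_four[OF nonneg, of p q r s \<eta>] xs k nnz by (intro exI[of _ 3]) auto
  qed
  then show ?thesis
    using unit_covers_mono by blast
qed

lemma unit_covers_sparse:
  fixes \<pi> :: "int ^ 'n"
  assumes k: "k \<in> {2, 3, 4}" and nnz: "nnz \<pi> \<le> k"
  shows "unit_covers (k - 1) \<pi> \<eta>"
proof (rule unit_covers_flip[of _ "{i. \<pi> $ i < 0}"], rule unit_covers_nonneg[OF _ k])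
  show "nnz (flip_normal {i. \<pi> $ i < 0} \<pi>) \<le> k"
    using nnz support_flip_normal[of "{i. \<pi> $ i < 0}" \<pi>] by (simp add: nnz_def support_def)
qed (simp add: flip_normal_def)

text \<open>
  A normal with at most \<open>k\<close> non-zero entries, all of them \<open>\<plusminus>1\<close>, takes only values between \<open>-k\<close> and
  \<open>k\<close> on the cube, so a single common point with the cube confines the offset.
\<close>

lemma split_set_mem_unit_split_sets:
  fixes \<sigma> :: "int ^ 'n"
  assumes coeffs: "\<forall>i. \<sigma> $ i \<in> {-1, 0, 1}" and nnz: "nnz \<sigma> \<le> k"
    and x: "x \<in> split_set \<sigma> \<theta>" "x \<in> cbox 0 1"
  shows "split_set \<sigma> \<theta> \<in> unit_split_sets k"
proof -
  let ?v = "\<Sum>i\<in>support \<sigma>. of_int (\<sigma> $ i) * x $ i"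
  have "\<bar>?v\<bar> \<le> (\<Sum>i\<in>support \<sigma>. \<bar>of_int (\<sigma> $ i) * x $ i\<bar>)"
    by (rule sum_abs)
  also have "\<dots> \<le> (\<Sum>i\<in>support \<sigma>. 1)"
  proof (rule sum_mono)
    fix i
    have "\<sigma> $ i = -1 \<or> \<sigma> $ i = 0 \<or> \<sigma> $ i = 1" "0 \<le> x $ i" "x $ i \<le> 1"
      using coeffs x(2) by (auto simp: mem_unit_cube)
    then show "\<bar>of_int (\<sigma> $ i) * x $ i\<bar> \<le> 1"
      by auto
  qed
  also have "\<dots> \<le> real k"
    using nnz by (simp add: nnz_def support_def)
  finally have "\<bar>?v\<bar> \<le> real k" .
  moreover have "of_int \<theta> < ?v" "?v < of_int \<theta> + 1"
    using x(1) by (simp_all add: mem_split_set[OF subset_refl])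
  ultimately have "\<theta> \<in> {- int k..int k}"
    by simp linarith
  then show ?thesis
    using coeffs nnz unfolding unit_split_sets_def by blast
qed

lemma domination_number_le_of_unit_covers:
  fixes \<pi> :: "int ^ 'n"
  assumes "unit_covers m \<pi> \<eta>" and nnz: "nnz \<pi> \<le> k"
  shows "domination_number (unit_split_sets k) (split_set \<pi> \<eta>) \<le> enat m"
proof -
  obtain \<G> where G: "finite \<G>" "card \<G> \<le> m" "dominates \<G> (split_set \<pi> \<eta>)"
      "\<And>U. U \<in> \<G> \<Longrightarrow> \<exists>\<sigma> \<theta>. U = split_set \<sigma> \<theta> \<and> (\<forall>i. \<sigma> $ i \<in> {-1, 0, 1}) \<and> support \<sigma> \<subseteq> support \<pi>"
    using assms unfolding unit_covers_def by blast
  \<comment> \<open>Only the splits that meet the cube are certain to have an admissible offset.\<close>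
  let ?H = "{U \<in> \<G>. U \<inter> cbox 0 1 \<noteq> {}}"
  have "?H \<subseteq> unit_split_sets k"
  proof
    fix U assume U: "U \<in> ?H"
    obtain \<sigma> \<theta> where s: "U = split_set \<sigma> \<theta>" "\<forall>i. \<sigma> $ i \<in> {-1, 0, 1}" "support \<sigma> \<subseteq> support \<pi>"
      using G(4) U by blast
    have "nnz \<sigma> \<le> nnz \<pi>"
      using s(3) card_mono[of "support \<pi>" "support \<sigma>"] by (simp add: nnz_def support_def)
    then show "U \<in> unit_split_sets k"
      using U s nnz split_set_mem_unit_split_sets[of \<sigma> k _ \<theta>] by auto
  qed
  moreover have "dominates ?H (split_set \<pi> \<eta>)"
    using G(3) unfolding dominates_def by blast
  moreover have "card ?H \<le> m"
    using G(1,2) card_mono[of \<G> ?H] by auto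
  ultimately show ?thesis
    unfolding domination_number_def using G(1)
    by (intro INF_lower2[of ?H]) auto
qed

theorem proposition4:
  fixes k :: nat
  assumes "k \<in> {2, 3, 4}"
  shows "covering_number k (unit_split_sets k :: (real ^ 'n) set set) \<le> enat (k - 1)"
  unfolding covering_number_def
proof (rule SUP_least)
  fix S :: "(real ^ 'n) set" assume "S \<in> {S. sparse_split_set k S}"
  then obtain \<pi> \<eta> where "S = split_set \<pi> \<eta>" "nnz \<pi> \<le> k"
    by (auto simp: sparse_split_set_def)
  then show "domination_number (unit_split_sets k) S \<le> enat (k - 1)"
    using domination_number_le_of_unit_covers[OF unit_covers_sparse[OF assms]] by blast
qed

end
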